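(* Let $N>1$ and $q>N-1$ be real numbers, and let $p=N=-\sigma$. Consider the positive solutions of $$-(|w'|^{N-2}w')'-\frac{N-1}{r}|w'|^{N-2}w'=\varepsilon r^{-N}w^{q},\qquad \varepsilon=\pm1 .$$ For $\varepsilon=-1$ there exist local explicit solutions near $0$ or near $\infty$ of the form $$w=(C\pm d_N\ln r)^{-\frac{N}{q-N+1}},\qquad C\in\mathbb{R},\qquad d_N=\frac{q-N+1}{N}\Bigl(\frac{N}{(N-1)(q+1)}\Bigr)^{\frac1N}.$$ For $\varepsilon=1$ there is no local solution near $0$ nor near $\infty$.
   Context: $N$ is not necessarily an integer. A local solution near $0$ (resp. near $\infty$) is a positive solution on $(0,r_0)$ (resp. $(r_0,\infty)$) for some $r_0>0$. *)

theory Defs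
  imports "HOL-Analysis.Analysis"
begin

text \<open>
  The flux \<open>|v|\<^sup>N\<^sup>-\<^sup>2 v\<close>. At \<open>v = 0\<close> it has the value 0 for every \<open>N > 1\<close>, as usual; note
  that \<open>0 powr a = 0\<close>, so this also holds for \<open>1 < N \<le> 2\<close>.
\<close>
definition flux :: "real \<Rightarrow> real \<Rightarrow> real" where
  "flux N v = \<bar>v\<bar> powr (N - 2) * v"

text \<open>
  Classical positive solutions on an open interval \<open>I \<subseteq> (0,\<infinity>)\<close>: \<open>w\<close> and \<open>|w'|\<^sup>N\<^sup>-\<^sup>2 w'\<close> are
  differentiable and the equation holds pointwise. Since \<open>flux N\<close> is a homeomorphism of the real
  line, \<open>w\<close> and its flux are then automatically continuously differentiable; \<open>w\<close> need not be
  twice differentiable at zeros of \<open>w'\<close>.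
\<close>
definition positive_solution_on ::
    "real \<Rightarrow> real \<Rightarrow> real \<Rightarrow> real set \<Rightarrow> (real \<Rightarrow> real) \<Rightarrow> bool" where
  "positive_solution_on N q \<epsilon> I w \<longleftrightarrow>
     (\<forall>r\<in>I. w r > 0
        \<and> w differentiable (at r)
        \<and> (\<lambda>s. flux N (deriv w s)) differentiable (at r)
        \<and> - deriv (\<lambda>s. flux N (deriv w s)) r - (N - 1) / r * flux N (deriv w r)
            = \<epsilon> * r powr (- N) * w r powr q)"

definition local_solution_near_0 :: "real \<Rightarrow> real \<Rightarrow> real \<Rightarrow> (real \<Rightarrow> real) \<Rightarrow> bool" where
  "local_solution_near_0 N q \<epsilon> w \<longleftrightarrow> (\<exists>r0>0. positive_solution_on N q \<epsilon> {0<..<r0} w)"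

definition local_solution_near_infinity :: "real \<Rightarrow> real \<Rightarrow> real \<Rightarrow> (real \<Rightarrow> real) \<Rightarrow> bool" where
  "local_solution_near_infinity N q \<epsilon> w \<longleftrightarrow> (\<exists>r0>0. positive_solution_on N q \<epsilon> {r0<..} w)"

definition d_const :: "real \<Rightarrow> real \<Rightarrow> real" where
  "d_const N q = (q - N + 1) / N * (N / ((N - 1) * (q + 1))) powr (1 / N)"

end

theory Submission
  imports Defs
begin

text \<open>
  The equation is invariant under dilations of \<open>r\<close>, so the logarithmic substitution
  \<open>t = \<plusminus> ln r\<close> makes it autonomous. Indeed \<open>r w'(r) = \<plusminus> v'(t)\<close> for \<open>w(r) = v(t)\<close>,
  and the damping term is absorbed by the integrating factor \<open>r\<^sup>N\<^sup>-\<^sup>1\<close>, which multiplicativity of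
  the flux turns into the passage from \<open>w'\<close> to \<open>r w'\<close>. The result is
  \<open>(|v'|\<^sup>N\<^sup>-\<^sup>2 v')' = -\<epsilon> v\<^sup>q\<close>, the same equation for both signs of \<open>t\<close>, so that a neighbourhood of
  \<open>0\<close> and a neighbourhood of \<open>\<infinity>\<close> both become a half-line \<open>t > t\<^sub>0\<close>.

  For \<open>\<epsilon> = -1\<close> one looks for a power of an affine function of \<open>t\<close>. Balancing the exponents forces
  \<open>v(t) = (C + d t)\<^sup>-\<^sup>a\<close> with \<open>a = N / (q - N + 1)\<close>, and balancing the coefficients forces
  \<open>d = d\<^sub>N\<close> when \<open>d > 0\<close>.

  For \<open>\<epsilon> = 1\<close> a positive \<open>v\<close> would be strictly concave on a half-line. A positive concave function
  on a half-line cannot decrease, hence \<open>v\<close> stays above a positive constant \<open>c\<close>; then the flux of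
  \<open>v'\<close> decreases at rate at least \<open>c\<^sup>q\<close> and becomes negative, contradicting \<open>v' \<ge> 0\<close>.
\<close>

section \<open>The flux\<close>

lemma flux_mult: "flux N (x * y) = flux N x * flux N y"
  by (simp add: flux_def abs_mult powr_mult)

lemma flux_of_pos: "x > 0 \<Longrightarrow> flux N x = x powr (N - 1)"
  using powr_add[of x "N - 2" 1] by (simp add: flux_def)

lemma flux_minus: "flux N (- x) = - flux N x"
  by (simp add: flux_def)

lemma flux_sign: "\<bar>\<sigma>\<bar> = 1 \<Longrightarrow> flux N \<sigma> = \<sigma>"
  by (simp add: flux_def)

lemma flux_nonneg_iff: "flux N x \<ge> 0 \<longleftrightarrow> x \<ge> 0"
  by (auto simp: flux_def zero_le_mult_iff)

lemma flux_mono: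
  assumes "N > 1" "x \<le> y"
  shows "flux N x \<le> flux N y"
proof -
  have pos: "flux N a \<le> flux N b" if "0 < a" "a \<le> b" for a b
    using that assms(1) by (simp add: flux_of_pos powr_mono2)
  consider "0 < x" | "y < 0" | "x \<le> 0" "0 \<le> y" by linarith
  then show ?thesis
  proof cases
    case 1
    then show ?thesis using pos assms by blast
  next
    case 2
    then show ?thesis using pos[of "- y" "- x"] assms by (simp add: flux_minus)
  next
    case 3
    then have "flux N (- x) \<ge> 0" "flux N y \<ge> 0" by (simp_all only: flux_nonneg_iff)
    then show ?thesis by (simp add: flux_minus)
  qed
qed

section \<open>The logarithmic substitution\<close>

text \<open>
  A solution of the radial equation becomes a solution of the autonomous one: with \<open>r = exp (\<sigma> t)\<close>
  the flux of \<open>v'\<close> is \<open>\<sigma> r\<^sup>N\<^sup>-\<^sup>1\<close> times the flux of \<open>w'\<close>, and the derivative of the factor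
  \<open>r\<^sup>N\<^sup>-\<^sup>1\<close> produces exactly the damping term.
\<close>
lemma autonomous_of_positive_solution:
  assumes sol: "positive_solution_on N q \<epsilon> I w" and \<sigma>: "\<bar>\<sigma>\<bar> = 1" and I: "exp (\<sigma> * t) \<in> I"
  shows "((\<lambda>t. w (exp (\<sigma> * t))) has_real_derivative \<sigma> * exp (\<sigma> * t) * deriv w (exp (\<sigma> * t))) (at t)"
    and "((\<lambda>t. flux N (\<sigma> * exp (\<sigma> * t) * deriv w (exp (\<sigma> * t))))
           has_real_derivative - \<epsilon> * w (exp (\<sigma> * t)) powr q) (at t)"
proof -
  define r where "r = exp (\<sigma> * t)"
  define \<Phi> where "\<Phi> s = flux N (deriv w s)" for s
  have r: "r > 0" by (simp add: r_def)
  have \<sigma>2: "\<sigma> * \<sigma> = 1" using \<sigma> by (metis abs_mult_self_eq mult_1)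
  have w: "(w has_real_derivative deriv w r) (at r)"
    and \<Phi>: "(\<Phi> has_real_derivative deriv \<Phi> r) (at r)"
    and eq: "- deriv \<Phi> r - (N - 1) / r * \<Phi> r = \<epsilon> * r powr (- N) * w r powr q"
    using sol I unfolding positive_solution_on_def r_def[symmetric] \<Phi>_def
    by (auto simp: DERIV_deriv_iff_real_differentiable)
  have e: "((\<lambda>t. exp (\<sigma> * t)) has_real_derivative \<sigma> * r) (at t)"
    unfolding r_def by (auto intro!: derivative_eq_intros)
  show "((\<lambda>t. w (exp (\<sigma> * t))) has_real_derivative \<sigma> * exp (\<sigma> * t) * deriv w (exp (\<sigma> * t))) (at t)"
    using DERIV_chain2[OF w[unfolded r_def] e] by (simp add: r_def mult_ac)
  have G: "((\<lambda>s. \<sigma> * s powr (N - 1) * \<Phi> s) has_real_derivative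
      \<sigma> * ((N - 1) * r powr (N - 2) * \<Phi> r + r powr (N - 1) * deriv \<Phi> r)) (at r)"
    using r by (auto intro!: derivative_eq_intros \<Phi> simp: algebra_simps)
  have p: "r powr (N - 2) = r powr N / r^2" "r powr (N - 1) = r powr N / r"
    "r powr (- N) = 1 / r powr N"
    using r by (simp_all add: powr_diff powr_minus_divide)
  have d: "deriv \<Phi> r = - ((N - 1) / r * \<Phi> r) - \<epsilon> * (1 / r powr N) * w r powr q"
    using eq unfolding p by linarith
  have "\<sigma> * ((N - 1) * r powr (N - 2) * \<Phi> r + r powr (N - 1) * deriv \<Phi> r) * (\<sigma> * r)
      = (\<sigma> * \<sigma>) * (- \<epsilon> * w r powr q)"
    unfolding d p using r by (simp add: field_simps power2_eq_square)
  then have val: "\<sigma> * ((N - 1) * r powr (N - 2) * \<Phi> r + r powr (N - 1) * deriv \<Phi> r) * (\<sigma> * r)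
      = - \<epsilon> * w r powr q" by (simp add: \<sigma>2)
  have "((\<lambda>t. \<sigma> * exp (\<sigma> * t) powr (N - 1) * \<Phi> (exp (\<sigma> * t))) has_real_derivative
      - \<epsilon> * w r powr q) (at t)"
    using DERIV_chain2[OF G[unfolded r_def] e] val by (simp add: r_def)
  moreover have "flux N (\<sigma> * exp (\<sigma> * t) * deriv w (exp (\<sigma> * t)))
      = \<sigma> * exp (\<sigma> * t) powr (N - 1) * \<Phi> (exp (\<sigma> * t))" for t
    by (simp only: flux_mult flux_sign[OF \<sigma>] flux_of_pos exp_gt_zero \<Phi>_def)
  ultimately show "((\<lambda>t. flux N (\<sigma> * exp (\<sigma> * t) * deriv w (exp (\<sigma> * t))))
           has_real_derivative - \<epsilon> * w (exp (\<sigma> * t)) powr q) (at t)"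
    by (simp add: r_def)
qed

text \<open>
  The converse passage, which turns explicit solutions of the autonomous equation into radial ones.
  Openness of \<open>I\<close> matters because the flux of \<open>w'\<close> is differentiated, so \<open>w'\<close> must be known on a
  whole neighbourhood of each point.
\<close>
lemma positive_solution_of_autonomous:
  assumes "open I" "I \<subseteq> {0<..}" and \<sigma>: "\<bar>\<sigma>\<bar> = 1"
    and pos: "\<And>r. r \<in> I \<Longrightarrow> v (\<sigma> * ln r) > 0"
    and v: "\<And>r. r \<in> I \<Longrightarrow> (v has_real_derivative V (\<sigma> * ln r)) (at (\<sigma> * ln r))"
    and V: "\<And>r. r \<in> I \<Longrightarrow> ((\<lambda>t. flux N (V t)) has_real_derivative
              - \<epsilon> * v (\<sigma> * ln r) powr q) (at (\<sigma> * ln r))"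
  shows "positive_solution_on N q \<epsilon> I (\<lambda>r. v (\<sigma> * ln r))"
  unfolding positive_solution_on_def
proof
  fix r assume rI: "r \<in> I"
  have \<sigma>2: "\<sigma> * \<sigma> = 1" using \<sigma> by (metis abs_mult_self_eq mult_1)
  let ?w = "\<lambda>r. v (\<sigma> * ln r)"
  let ?G = "\<lambda>s. \<sigma> * s powr (1 - N) * flux N (V (\<sigma> * ln s))"
  have r: "r > 0" using rI assms(2) by auto
  have l: "((\<lambda>s. \<sigma> * ln s) has_real_derivative \<sigma> / s) (at s)" if "s > 0" for s
    using that by (auto intro!: derivative_eq_intros)
  have w: "(?w has_real_derivative V (\<sigma> * ln s) * (\<sigma> / s)) (at s)" if "s \<in> I" for s
    using DERIV_chain2[OF v[OF that] l] that assms(2) by auto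
  have "flux N (deriv ?w s) = ?G s" if "s \<in> I" for s
  proof -
    have s: "s > 0" using that assms(2) by auto
    have "flux N (deriv ?w s) = flux N (V (\<sigma> * ln s) * (\<sigma> * (1 / s)))"
      using DERIV_imp_deriv[OF w[OF that]] by simp
    also have "\<dots> = flux N (V (\<sigma> * ln s)) * (\<sigma> * (1 / s) powr (N - 1))"
      using s by (simp only: flux_mult flux_sign[OF \<sigma>] flux_of_pos zero_less_divide_1_iff)
    also have "(1 / s) powr (N - 1) = s powr (1 - N)"
      using s by (simp add: powr_divide powr_minus_divide[symmetric])
    finally show ?thesis by simp
  qed
  then have fl: "\<forall>\<^sub>F s in nhds r. flux N (deriv ?w s) = ?G s"
    using rI \<open>open I\<close> eventually_nhds by blast
  have H: "((\<lambda>s. flux N (V (\<sigma> * ln s))) has_real_derivative - \<epsilon> * ?w r powr q * (\<sigma> / r)) (at r)"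
    using DERIV_chain2[OF V[OF rI] l[OF r]] .
  let ?D = "\<sigma> * ((1 - N) * r powr (- N) * flux N (V (\<sigma> * ln r))
        + r powr (1 - N) * (- \<epsilon> * ?w r powr q * (\<sigma> / r)))"
  have G: "(?G has_real_derivative ?D) (at r)"
    using r by (auto intro!: derivative_eq_intros H simp: algebra_simps)
  have F: "((\<lambda>s. flux N (deriv ?w s)) has_real_derivative ?D) (at r)"
    using DERIV_cong_ev[OF refl fl refl] G by blast
  have p: "r powr (1 - N) = r * r powr (- N)" using r by (simp add: powr_diff powr_minus field_simps)
  have "- ?D - (N - 1) / r * ?G r = (\<sigma> * \<sigma>) * (\<epsilon> * r powr (- N) * ?w r powr q)"
    using r by (simp add: p field_simps)
  then have "- deriv (\<lambda>s. flux N (deriv ?w s)) r - (N - 1) / r * flux N (deriv ?w r)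
      = \<epsilon> * r powr (- N) * ?w r powr q"
    using DERIV_imp_deriv[OF F] eventually_nhds_x_imp_x[OF fl] by (simp add: \<sigma>2)
  then show "?w r > 0 \<and> ?w differentiable (at r)
      \<and> (\<lambda>s. flux N (deriv ?w s)) differentiable (at r)
      \<and> - deriv (\<lambda>s. flux N (deriv ?w s)) r - (N - 1) / r * flux N (deriv ?w r)
          = \<epsilon> * r powr (- N) * ?w r powr q"
    using pos[OF rI] w[OF rI] F by (auto simp: real_differentiable_def)
qed

section \<open>Nonexistence for the source sign\<close>

text \<open>
  The concavity argument. It is phrased with a derivative \<open>V\<close> whose flux, rather than \<open>V\<close> itself,
  is differentiable; monotonicity of the flux is what converts the decrease of \<open>flux N (V t)\<close> into
  concavity of \<open>v\<close>.
\<close>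
lemma no_positive_autonomous_solution:
  assumes N: "N > 1" and q: "q \<ge> 0"
    and pos: "\<And>t. t > t0 \<Longrightarrow> v t > 0"
    and v: "\<And>t. t > t0 \<Longrightarrow> (v has_real_derivative V t) (at t)"
    and V: "\<And>t. t > t0 \<Longrightarrow> ((\<lambda>t. flux N (V t)) has_real_derivative - (v t powr q)) (at t)"
  shows False
proof -
  have dec: "V b \<le> V a" if "t0 < a" "a < b" for a b
  proof -
    have "flux N (V b) < flux N (V a)"
      using DERIV_neg_imp_decreasing[OF that(2), of "\<lambda>t. flux N (V t)"] V pos that
      by (smt (verit) powr_gt_zero)
    then show ?thesis using flux_mono[OF N, of "V a" "V b"] by linarith
  qed
  have V_nonneg: "V a \<ge> 0" if a: "t0 < a" for a
  proof (rule ccontr)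
    assume neg: "\<not> V a \<ge> 0"
    \<comment> \<open>The tangent line at \<open>a\<close>, which lies above \<open>v\<close>, vanishes at \<open>b\<close>.\<close>
    define b where "b = a - v a / V a"
    have ab: "a < b" using neg pos[OF a] by (simp add: b_def divide_neg_pos divide_pos_neg)
    obtain z where z: "z > a" "z < b" "v b - v a = (b - a) * V z"
      using MVT2[OF ab, of v V] v a by force
    have "(b - a) * V z \<le> (b - a) * V a"
      using dec[OF a z(1)] ab by (intro mult_left_mono) auto
    also have "\<dots> = - v a" using neg by (simp add: b_def)
    finally show False using z(3) pos[of b] ab a by linarith
  qed
  define a where "a = t0 + 1"
  define k where "k = v a powr q"
  have a: "a > t0" by (simp add: a_def)
  have k: "k > 0" using pos[OF a] by (simp add: k_def)
  \<comment> \<open>The flux of \<open>V\<close> starts at \<open>flux N (V a)\<close> and falls at rate at least \<open>k\<close>, so it is negative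
    at \<open>b\<close>.\<close>
  define b where "b = a + (flux N (V a) + 1) / k"
  have f0: "flux N (V a) \<ge> 0" using V_nonneg[OF a] by (simp only: flux_nonneg_iff)
  then have ab: "a < b" using k by (simp add: b_def add_nonneg_pos)
  obtain z where z: "z > a" "z < b" "flux N (V b) - flux N (V a) = (b - a) * - (v z powr q)"
    using MVT2[OF ab, of "\<lambda>t. flux N (V t)" "\<lambda>t. - (v t powr q)"] V a by force
  have "v a \<le> v z"
    using DERIV_nonneg_imp_nondecreasing[of a z v] z(1) v V_nonneg a by (smt (verit))
  then have "k \<le> v z powr q" using pos[OF a] q by (simp add: k_def powr_mono2)
  then have "(b - a) * k \<le> (b - a) * v z powr q" using ab by (intro mult_left_mono) auto
  moreover have "(b - a) * k = flux N (V a) + 1" using k by (simp add: b_def)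
  ultimately have "flux N (V b) < 0" using z(3) by simp
  moreover have "flux N (V b) \<ge> 0" using V_nonneg[of b] ab a by (simp only: flux_nonneg_iff)
  ultimately show False by linarith
qed

lemma no_positive_solution_along_log_ray:
  assumes "N > 1" "q \<ge> 0" "\<bar>\<sigma>\<bar> = 1"
    and sol: "positive_solution_on N q 1 I w" and I: "\<And>t. t > t0 \<Longrightarrow> exp (\<sigma> * t) \<in> I"
  shows False
proof (rule no_positive_autonomous_solution[OF assms(1,2)])
  fix t assume t: "t > t0"
  show "w (exp (\<sigma> * t)) > 0" using sol I[OF t] by (auto simp: positive_solution_on_def)
  show "((\<lambda>t. w (exp (\<sigma> * t))) has_real_derivative \<sigma> * exp (\<sigma> * t) * deriv w (exp (\<sigma> * t))) (at t)"
    using autonomous_of_positive_solution(1)[OF sol assms(3) I[OF t]] .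
  show "((\<lambda>t. flux N (\<sigma> * exp (\<sigma> * t) * deriv w (exp (\<sigma> * t))))
           has_real_derivative - (w (exp (\<sigma> * t)) powr q)) (at t)"
    using autonomous_of_positive_solution(2)[OF sol assms(3) I[OF t]] by simp
qed

section \<open>Explicit solutions for the absorption sign\<close>

lemma d_const_pos:
  assumes "N > 1" "q > N - 1"
  shows "d_const N q > 0"
  using assms by (auto simp: d_const_def intro!: mult_pos_pos divide_pos_pos)

text \<open>
  The two balances behind the ansatz: in \<open>(|v'|\<^sup>N\<^sup>-\<^sup>2 v')' = v\<^sup>q\<close> with \<open>v(t) = s\<^sup>-\<^sup>a\<close>,
  \<open>s = C + d t\<close>, the left side is \<open>(a d)\<^sup>N\<^sup>-\<^sup>1 (a + 1)(N - 1) d s\<^sup>-\<^sup>(\<^sup>a\<^sup>+\<^sup>1\<^sup>)\<^sup>(\<^sup>N\<^sup>-\<^sup>1\<^sup>)\<^sup>-\<^sup>1\<close>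
  and the right side is \<open>s\<^sup>-\<^sup>a\<^sup>q\<close>.
\<close>
lemma ansatz_balance:
  assumes N: "N > 1" and q: "q > N - 1"
  defines "a \<equiv> N / (q - N + 1)" and "d \<equiv> d_const N q"
  shows "(a + 1) * (N - 1) + 1 = a * q"
    and "(a * d) powr (N - 1) * ((a + 1) * (N - 1) * d) = 1"
proof -
  have m: "q - N + 1 > 0" "q + 1 > 0" using N q by auto
  show "(a + 1) * (N - 1) + 1 = a * q"
    using m by (simp add: a_def field_simps)
  have ad: "a * d = (N / ((N - 1) * (q + 1))) powr (1 / N)"
    using m N by (simp add: a_def d_def d_const_def)
  have adp: "a * d > 0" unfolding ad using N m by simp
  have "(a * d) powr (N - 1) * (a * d) = (a * d) powr N"
    using powr_add[of "a * d" "N - 1" 1] adp by simp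
  also have "\<dots> = N / ((N - 1) * (q + 1))"
    unfolding ad using N m by (simp add: powr_powr)
  finally have k: "(a * d) powr (N - 1) * (a * d) = N / ((N - 1) * (q + 1))" .
  have "a + 1 = (q + 1) / (q - N + 1)" using m by (simp add: a_def field_simps)
  then have c: "(a + 1) * (N - 1) = a * ((q + 1) * (N - 1) / N)"
    using N by (simp add: a_def)
  have "(a * d) powr (N - 1) * ((a + 1) * (N - 1) * d)
      = ((a * d) powr (N - 1) * (a * d)) * ((q + 1) * (N - 1) / N)"
    unfolding c by simp
  also have "\<dots> = 1" unfolding k using N m by simp
  finally show "(a * d) powr (N - 1) * ((a + 1) * (N - 1) * d) = 1" .
qed

lemma explicit_positive_solution:
  assumes N: "N > 1" and q: "q > N - 1" and "open I" "I \<subseteq> {0<..}" and \<sigma>: "\<bar>\<sigma>\<bar> = 1"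
    and pos: "\<And>r. r \<in> I \<Longrightarrow> C + d_const N q * (\<sigma> * ln r) > 0"
  shows "positive_solution_on N q (-1) I
           (\<lambda>r. (C + d_const N q * (\<sigma> * ln r)) powr (- (N / (q - N + 1))))"
proof -
  define a where "a = N / (q - N + 1)"
  define d where "d = d_const N q"
  define b where "b = (a + 1) * (N - 1)"
  define V where "V t = - (a * d) * (C + d * t) powr (- a - 1)" for t
  have ad: "a * d > 0" using N q d_const_pos[OF N q] by (simp add: a_def d_def)
  have exps: "b + 1 = a * q" and coef: "(a * d) powr (N - 1) * (b * d) = 1"
    using ansatz_balance[OF N q] unfolding a_def d_def b_def by auto
  have vD: "((\<lambda>t. (C + d * t) powr (- a)) has_real_derivative V t) (at t)" if "C + d * t > 0" for t
    unfolding V_def using that by (auto intro!: derivative_eq_intros)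
  have VD: "((\<lambda>t. flux N (V t)) has_real_derivative - (- 1) * ((C + d * t) powr (- a)) powr q) (at t)"
    if t: "C + d * t > 0" for t
  proof -
    have "open {s. C + d * s > 0}" by (intro open_Collect_less continuous_intros)
    moreover have "flux N (V s) = - ((a * d) powr (N - 1) * (C + d * s) powr (- b))"
      if "C + d * s > 0" for s
    proof -
      have "flux N (V s) = - (flux N (a * d) * flux N ((C + d * s) powr (- a - 1)))"
        unfolding V_def by (simp only: flux_mult[symmetric] flux_minus[symmetric] mult_minus_left)
      also have "\<dots> = - ((a * d) powr (N - 1) * ((C + d * s) powr (- a - 1)) powr (N - 1))"
        using ad that by (simp add: flux_of_pos)
      also have "((C + d * s) powr (- a - 1)) powr (N - 1) = (C + d * s) powr (- b)"
        by (simp add: powr_powr b_def algebra_simps)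
      finally show ?thesis .
    qed
    ultimately have fl: "\<forall>\<^sub>F s in nhds t. flux N (V s) = - ((a * d) powr (N - 1) * (C + d * s) powr (- b))"
      using t eventually_nhds by blast
    have "((\<lambda>s. - ((a * d) powr (N - 1) * (C + d * s) powr (- b))) has_real_derivative
        (a * d) powr (N - 1) * (b * d) * (C + d * t) powr (- b - 1)) (at t)"
      using t by (auto intro!: derivative_eq_intros)
    moreover have "- b - 1 = - a * q" using exps by simp
    then have "(C + d * t) powr (- b - 1) = ((C + d * t) powr (- a)) powr q"
      by (simp only: powr_powr)
    ultimately have "((\<lambda>s. - ((a * d) powr (N - 1) * (C + d * s) powr (- b))) has_real_derivative
        - (- 1) * ((C + d * t) powr (- a)) powr q) (at t)" by (simp add: coef)
    then show ?thesis using DERIV_cong_ev[OF refl fl refl] by blast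
  qed
  have "positive_solution_on N q (-1) I (\<lambda>r. (C + d * (\<sigma> * ln r)) powr (- a))"
  proof (rule positive_solution_of_autonomous[where V = V and v = "\<lambda>t. (C + d * t) powr (- a)"])
    fix r assume "r \<in> I"
    then have s: "C + d * (\<sigma> * ln r) > 0" using pos by (simp add: d_def)
    show "(C + d * (\<sigma> * ln r)) powr (- a) > 0" using s by simp
    show "((\<lambda>t. (C + d * t) powr (- a)) has_real_derivative V (\<sigma> * ln r)) (at (\<sigma> * ln r))"
      using vD[OF s] .
    show "((\<lambda>t. flux N (V t)) has_real_derivative
        - (- 1) * ((C + d * (\<sigma> * ln r)) powr (- a)) powr q) (at (\<sigma> * ln r))"
      using VD[OF s] .
  qed (use assms in auto)
  then show ?thesis by (simp add: a_def d_def)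
qed

section \<open>Local solutions near the origin and near infinity\<close>

theorem theorem4p21:
  fixes N q :: real
  assumes "N > 1" and "q > N - 1"
  shows "(\<forall>C::real.
            (\<forall>\<^sub>F r in at_right 0. C - d_const N q * ln r > 0)
          \<and> local_solution_near_0 N q (-1)
              (\<lambda>r. (C - d_const N q * ln r) powr (- (N / (q - N + 1)))))
       \<and> (\<forall>C::real.
            (\<forall>\<^sub>F r in at_top. C + d_const N q * ln r > 0)
          \<and> local_solution_near_infinity N q (-1)
              (\<lambda>r. (C + d_const N q * ln r) powr (- (N / (q - N + 1)))))
       \<and> \<not> (\<exists>w. local_solution_near_0 N q 1 w)
       \<and> \<not> (\<exists>w. local_solution_near_infinity N q 1 w)"
proof (intro conjI allI notI)
  define d where "d = d_const N q"
  have d: "d > 0" using d_const_pos[OF assms] by (simp add: d_def)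
  have q: "q \<ge> 0" using assms by simp
  fix C :: real
  have near0: "C - d * ln r > 0" if "r \<in> {0<..<exp (C / d)}" for r
  proof -
    have "ln r < C / d" using that ln_less_cancel_iff[of r "exp (C / d)"] by simp
    then show ?thesis using d by (simp add: field_simps)
  qed
  have near_inf: "C + d * ln r > 0" if "r \<in> {exp (- C / d)<..}" for r
  proof -
    have "0 < r" using that by (auto intro: less_trans[OF exp_gt_zero])
    then have "- C / d < ln r" using that ln_less_cancel_iff[of "exp (- C / d)" r] by simp
    then show ?thesis using d by (simp add: field_simps)
  qed
  have "\<forall>\<^sub>F r in at_right 0. r \<in> {0<..<exp (C / d)}"
    by (intro eventually_at_right_real) simp
  then show "\<forall>\<^sub>F r in at_right 0. C - d_const N q * ln r > 0"
    by eventually_elim (use near0 in \<open>simp add: d_def\<close>)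
  have "\<forall>\<^sub>F r in at_top. r \<in> {exp (- C / d)<..}"
    by (simp add: eventually_gt_at_top)
  then show "\<forall>\<^sub>F r in at_top. C + d_const N q * ln r > 0"
    by eventually_elim (use near_inf in \<open>simp add: d_def\<close>)
  have "positive_solution_on N q (-1) {0<..<exp (C / d)}
      (\<lambda>r. (C + d_const N q * (- 1 * ln r)) powr (- (N / (q - N + 1))))"
    by (rule explicit_positive_solution[OF assms]) (use near0 in \<open>auto simp: d_def\<close>)
  then show "local_solution_near_0 N q (-1)
      (\<lambda>r. (C - d_const N q * ln r) powr (- (N / (q - N + 1))))"
    unfolding local_solution_near_0_def by (intro exI[of _ "exp (C / d)"]) simp
  have "positive_solution_on N q (-1) {exp (- C / d)<..}
      (\<lambda>r. (C + d_const N q * (1 * ln r)) powr (- (N / (q - N + 1))))"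
    by (rule explicit_positive_solution[OF assms])
      (use near_inf in \<open>auto simp: d_def intro: less_trans[OF exp_gt_zero]\<close>)
  then show "local_solution_near_infinity N q (-1)
      (\<lambda>r. (C + d_const N q * ln r) powr (- (N / (q - N + 1))))"
    unfolding local_solution_near_infinity_def by (intro exI[of _ "exp (- C / d)"]) simp
next
  have q: "q \<ge> 0" using assms by simp
  assume "\<exists>w. local_solution_near_0 N q 1 w"
  then obtain w r0 where r0: "r0 > 0" and sol: "positive_solution_on N q 1 {0<..<r0} w"
    by (auto simp: local_solution_near_0_def)
  have "exp (- 1 * t) \<in> {0<..<r0}" if "t > - ln r0" for t
    using that r0 exp_less_cancel_iff[of "- t" "ln r0"] by simp
  then show False
    using no_positive_solution_along_log_ray[OF assms(1) q _ sol, of "- 1" "- ln r0"] by simp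
next
  have q: "q \<ge> 0" using assms by simp
  assume "\<exists>w. local_solution_near_infinity N q 1 w"
  then obtain w r0 where r0: "r0 > 0" and sol: "positive_solution_on N q 1 {r0<..} w"
    by (auto simp: local_solution_near_infinity_def)
  have "exp (1 * t) \<in> {r0<..}" if "t > ln r0" for t
    using that r0 exp_less_cancel_iff[of "ln r0" t] by simp
  then show False
    using no_positive_solution_along_log_ray[OF assms(1) q _ sol, of 1 "ln r0"] by simp
qed

end
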